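(* Let $m_1,m_2,\dots,m_n,M_1,M_2,\dots,M_n\in SL(2,\mathbb{C})$ and let $\varepsilon_1,\varepsilon_2,\dots,\varepsilon_n\in\{\pm1\}$. Define the $n\times n$ matrix $D=(D_{i,j})_{1\le i,j\le n}$ by $D_{i,j}=\operatorname{tr}(m_iM_j^{\varepsilon_i})$. If $n\ge5$, then $\det D=0$.
   Context: $SL(2,\mathbb{C})$ is the group of complex $2\times2$ matrices of determinant $1$, and $\operatorname{tr}$ denotes the trace. *)

theory Defs
  imports "HOL-Analysis.Analysis"
begin

definition SL2C :: "(complex^2^2) set" where
  "SL2C = {A. det A = 1}"

(* Integer powers with respect to the matrix product **, to which the overloaded powers ^ and powi
   do not refer. For a negative exponent the base is meant to be invertible. *)
definition mat_powi :: "'a::semiring_1^'n^'n \<Rightarrow> int \<Rightarrow> 'a^'n^'n" where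
  "mat_powi A k =
     (if k \<ge> 0 then (((**) A) ^^ nat k) (mat 1)
      else (((**) (matrix_inv A)) ^^ nat (- k)) (mat 1))"

lemma mat_powi_1: "mat_powi A 1 = A"
  by (simp add: mat_powi_def)

lemma mat_powi_minus_1: "mat_powi A (- 1) = matrix_inv A"
  by (simp add: mat_powi_def)

end

theory Submission
  imports Defs
begin

text \<open>
  All rows of \<open>D\<close> can be brought to the same form: where \<open>\<epsilon> i = -1\<close>, the inverse moves from \<open>M j\<close>
  to \<open>m i\<close>. The reason is that a 2 by 2 matrix of determinant 1 has the same trace as its inverse.
  The product \<open>m ** inverse M\<close> has the inverse \<open>M ** inverse m\<close>, and the trace is cyclic, so
  \<open>trace (m ** inverse M) = trace (inverse m ** M)\<close>. Hence \<open>D $ i $ j = trace (A i ** M j)\<close>, where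
  \<open>A i\<close> is the \<open>\<epsilon> i\<close>-th power of \<open>m i\<close> and depends on the row only: the entries of \<open>D\<close> are values of
  a single bilinear form.

  A matrix of values of a bilinear form on a vector space of dimension \<open>d\<close> factors through that
  space, so its rank is at most \<open>d\<close>. Here the space consists of the 2 by 2 matrices and \<open>d = 4\<close>,
  which is too small for \<open>D\<close> to be invertible when it has at least five rows.
\<close>

text \<open>
  If the product were invertible, then \<open>B\<close> would be an injective linear map into a space of smaller
  dimension.
\<close>

lemma det_matrix_mult_eq_0_if_inner_dim_less:
  fixes A :: "'a::field^'k^'n" and B :: "'a^'n^'k"
  assumes "CARD('k) < CARD('n)"
  shows "det (A ** B) = 0"
proof (rule ccontr)
  assume "det (A ** B) \<noteq> 0"
  then obtain C where "C ** (A ** B) = mat 1"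
    by (meson invertible_det_nz invertible_def)
  then have "(C ** A) ** B = mat 1"
    by (simp add: matrix_mul_assoc)
  then have "inj ((*v) B)"
    by (meson matrix_left_invertible_injective)
  then have "vec.dim (range ((*v) B)) = vec.dim (UNIV :: ('a^'n) set)"
    by (intro vec.dim_image_eq) (auto intro: inj_on_subset)
  then have "CARD('n) \<le> CARD('k)"
    by (metis dim_subset_UNIV_cart_gen vec_dim_card)
  with assms show False
    by simp
qed

text \<open>
  The trace form on square matrices of size \<open>k\<close> is the standard dot product of their \<open>k * k\<close> entries,
  up to a transposition. Indexing these entries by pairs exhibits the factorization.
\<close>

lemma det_trace_form_eq_0:
  fixes A B :: "'n::finite \<Rightarrow> 'a::field^'k^'k"
  assumes "CARD('k) * CARD('k) < CARD('n)"
  shows "det (\<chi> i j. trace (A i ** B j)) = 0"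
proof -
  define P :: "'a^('k \<times> 'k)^'n" where "P = (\<chi> i pq. A i $ fst pq $ snd pq)"
  define Q :: "'a^'n^('k \<times> 'k)" where "Q = (\<chi> pq j. B j $ snd pq $ fst pq)"
  have "(\<chi> i j. trace (A i ** B j)) = P ** Q"
    by (simp add: P_def Q_def vec_eq_iff trace_def matrix_matrix_mult_def sum.cartesian_product
        case_prod_beta)
  also have "det (P ** Q) = 0"
    using assms by (intro det_matrix_mult_eq_0_if_inner_dim_less) simp
  finally show ?thesis .
qed

lemma matrix_inv_eqI:
  fixes A B :: "'a::field^'n^'n"
  assumes "A ** B = mat 1"
  shows "matrix_inv A = B"
proof -
  have "invertible A"
    using assms invertible_right_inverse by blast
  then have "matrix_inv A ** A = mat 1"
    unfolding invertible_def matrix_inv_def by (rule someI2_ex) simp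
  then show ?thesis
    using assms by (metis matrix_mul_assoc matrix_mul_lid matrix_mul_rid)
qed

lemma SL2C_inverse:
  assumes "A \<in> SL2C"
  shows "matrix_inv A = vector [vector [A$2$2, - A$1$2], vector [- A$2$1, A$1$1]]"
proof (rule matrix_inv_eqI)
  show "A ** vector [vector [A$2$2, - A$1$2], vector [- A$2$1, A$1$1]] = mat 1"
    using assms
    by (simp add: SL2C_def det_2 vec_eq_iff forall_2 matrix_matrix_mult_def sum_2 mat_def
        vector_2 algebra_simps)
qed

text \<open>
  In coordinates the inverse is the adjugate, so both sides are the same bilinear polynomial in the
  entries of \<open>A\<close> and \<open>B\<close>.
\<close>

lemma trace_SL2C_mult_inverse:
  assumes "A \<in> SL2C" "B \<in> SL2C"
  shows "trace (A ** matrix_inv B) = trace (matrix_inv A ** B)"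
  using assms
  by (simp add: SL2C_inverse trace_def matrix_matrix_mult_def sum_2 vector_2 algebra_simps)

theorem theorem2:
  fixes m M :: "'n::finite \<Rightarrow> complex^2^2"
    and \<epsilon> :: "'n \<Rightarrow> int"
    and D :: "complex^'n^'n"
  assumes "\<And>i. m i \<in> SL2C"
    and "\<And>i. M i \<in> SL2C"
    and "\<And>i. \<epsilon> i \<in> {1, - 1}"
    and "D = (\<chi> i j. trace (m i ** mat_powi (M j) (\<epsilon> i)))"
    and "CARD('n) \<ge> 5"
  shows "det D = 0"
proof -
  have "trace (m i ** mat_powi (M j) (\<epsilon> i)) = trace (mat_powi (m i) (\<epsilon> i) ** M j)" for i j
    using assms(1)[of i] assms(2)[of j] assms(3)[of i]
    by (auto simp: mat_powi_1 mat_powi_minus_1 trace_SL2C_mult_inverse)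
  then have "D = (\<chi> i j. trace (mat_powi (m i) (\<epsilon> i) ** M j))"
    using assms(4) by simp
  then show ?thesis
    using assms(5) by (simp add: det_trace_form_eq_0)
qed

end
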